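(* Let $A$ and $k$ be positive integers and consider the equation \[\sigma_2(n)-n^2=An+(k^2+1)\] in positive integers $n$. (i) If $A\neq 2$ or $k$ is odd, then the equation has only finitely many solutions. (ii) If $A=2$ and $k$ is even, then every solution $n$ with $n\ge (|A|+k^2+1)^3$ is of the form $n=p(p+k)$, where both $p$ and $p+k$ are primes.
   Context: $\sigma_2(n)=\sum_{d\mid n}d^2$. *)

theory Defs
  imports Complex_Main "HOL-Computational_Algebra.Primes"
begin

definition sigma2 :: "nat \<Rightarrow> nat" where
  "sigma2 n = (\<Sum>d | d dvd n. d ^ 2)"

end

theory Submission
  imports Defs
begin

text \<open>
  A solution \<open>n\<close> is composite, and if \<open>p\<close> is its least prime factor, then the divisor \<open>n/p\<close> alone
  gives \<open>(n/p)\<^sup>2 < C n\<close> with \<open>C = A + k\<^sup>2 + 1\<close>. For \<open>n \<ge> C\<^sup>3\<close> this leaves no room for a third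
  prime factor, so \<open>n = p q\<close> with primes \<open>p < q\<close> and \<open>p\<^sup>2 + q\<^sup>2 = A p q + k\<^sup>2\<close>. Modulo \<open>q\<close> this
  gives \<open>q | (p - k)(p + k)\<close>, hence \<open>q \<le> p + k\<close> unless \<open>p = k\<close>. But for \<open>A \<ge> 3\<close> the
  equation forces \<open>q - p > k\<close>, for \<open>A = 1\<close> it forces \<open>n \<le> k\<^sup>2\<close>, and for \<open>A = 2\<close> it reads
  \<open>q - p = k\<close>.
\<close>

lemma divisors_prime_times_prime:
  fixes p q :: nat
  assumes "prime p" "prime q"
  shows "{d. d dvd p * q} = {1, p, q, p * q}"
proof (intro equalityI subsetI)
  fix d assume "d \<in> {d. d dvd p * q}"
  then obtain b c where "d = b * c" "b dvd p" "c dvd q"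
    using division_decomp[of d p q] by auto
  moreover have "b = 1 \<or> b = p" "c = 1 \<or> c = q"
    using assms calculation by (auto simp: prime_nat_iff)
  ultimately show "d \<in> {1, p, q, p * q}" by auto
qed auto

lemma sigma2_prime:
  assumes "prime p"
  shows "sigma2 p = 1 + p\<^sup>2"
proof -
  have "{d. d dvd p} = {1, p}" using assms by (auto simp: prime_nat_iff)
  then show ?thesis using prime_gt_1_nat[OF assms] by (simp add: sigma2_def)
qed

text \<open>Stated apart from the case of distinct primes because the four listed divisors collapse
  to three, so \<open>p\<close> contributes only once.\<close>

lemma sigma2_prime_square:
  assumes "prime p"
  shows "sigma2 (p * p) = 1 + p\<^sup>2 + (p * p)\<^sup>2"
proof -
  have "p * p \<noteq> p" "p * p \<noteq> 1" using prime_gt_1_nat[OF assms] by auto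
  then show ?thesis
    using prime_gt_1_nat[OF assms] divisors_prime_times_prime[OF assms assms]
    by (simp add: sigma2_def)
qed

lemma sigma2_prime_times_prime:
  assumes "prime p" "prime q" "p \<noteq> q"
  shows "sigma2 (p * q) = 1 + p\<^sup>2 + q\<^sup>2 + (p * q)\<^sup>2"
proof -
  have "p > 1" "q > 1" using assms prime_gt_1_nat by blast+
  then have "p * q \<noteq> p" "p * q \<noteq> q" "p * q \<noteq> 1" by auto
  then show ?thesis
    using \<open>p > 1\<close> \<open>q > 1\<close> assms(3) divisors_prime_times_prime[OF assms(1,2)]
    by (simp add: sigma2_def)
qed

lemma sigma2_ge_proper_divisor:
  assumes "m dvd n" "1 < m" "m < n"
  shows "1 + m\<^sup>2 + n\<^sup>2 \<le> sigma2 n"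
proof -
  have "(\<Sum>d\<in>{1, m, n}. d\<^sup>2) \<le> (\<Sum>d | d dvd n. d\<^sup>2)"
    using assms by (intro sum_mono2) auto
  then show ?thesis using assms by (simp add: sigma2_def)
qed

text \<open>With \<open>p\<close> the least prime factor and \<open>m\<close> = n/p, the equation
  gives m < C p. A composite \<open>m\<close> would be at least p^2, forcing p < C and then n <
  C^3.\<close>

lemma large_solution_is_product_of_two_primes:
  fixes A k n :: nat
  assumes "A > 0" "k > 0" "n > 0"
    and eq: "sigma2 n = n\<^sup>2 + A * n + k\<^sup>2 + 1"
    and large: "(A + k\<^sup>2 + 1) ^ 3 \<le> n"
  obtains p q where "prime p" "prime q" "p < q" "n = p * q" "p\<^sup>2 + q\<^sup>2 = A * (p * q) + k\<^sup>2"
proof -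
  define C where "C = A + k\<^sup>2 + 1"
  have "n \<noteq> 1" using eq by (auto simp: sigma2_def)
  define p where "p = (LEAST p. prime p \<and> p dvd n)"
  have p: "prime p" "p dvd n"
    using LeastI_ex[OF prime_factor_nat[OF \<open>n \<noteq> 1\<close>]] by (auto simp: p_def)
  have p_le: "p \<le> d" if "d dvd n" "d \<noteq> 1" for d
  proof -
    obtain r where "prime r" "r dvd d" using prime_factor_nat[OF \<open>d \<noteq> 1\<close>] by blast
    then have "p \<le> r" unfolding p_def using that by (intro Least_le) (auto intro: dvd_trans)
    also have "r \<le> d" using \<open>r dvd d\<close> dvd_pos_nat[OF \<open>n > 0\<close> that(1)] by (rule dvd_imp_le)
    finally show ?thesis .
  qed
  have "p > 1" using p prime_gt_1_nat by blast
  obtain m where m: "n = p * m" using p by auto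
  \<comment> \<open>A prime \<open>n\<close> has \<open>sigma2 n\<close> = 1 + n^2, which would
    force A n + k^2 = 0.\<close>
  have "m \<noteq> 1" using eq p assms(1,3) by (auto simp: m sigma2_prime)
  then have "m > 1" using \<open>n > 0\<close> m by (cases m) auto
  then have "m < n" using \<open>p > 1\<close> m by simp
  \<comment> \<open>The divisors 1 and \<open>n\<close> account for the summands 1 and n^2 of the
    equation; m^2 must fit into the rest, which is below C n = C p m.\<close>
  have "m\<^sup>2 \<le> A * n + k\<^sup>2"
    using sigma2_ge_proper_divisor[of m n] \<open>m > 1\<close> \<open>m < n\<close> eq m by simp
  also have "k\<^sup>2 \<le> k\<^sup>2 * n" using \<open>n > 0\<close> by simp
  also have "A * n + k\<^sup>2 * n < C * n" using \<open>n > 0\<close> by (simp add: C_def algebra_simps)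
  finally have "m * m < m * (C * p)" by (simp add: m power2_eq_square mult_ac)
  then have m_less: "m < C * p" by simp
  have "prime m"
  proof (rule ccontr)
    assume "\<not> prime m"
    then obtain a where a: "a dvd m" "a \<noteq> 1" "a \<noteq> m"
      using \<open>m > 1\<close> by (auto simp: prime_nat_iff)
    then obtain b where b: "m = a * b" by auto
    \<comment> \<open>Both factors divide \<open>n\<close> and differ from 1 (\<open>b\<close>
      because a \<noteq> m), so minimality of \<open>p\<close> applies to each.\<close>
    have "p \<le> a" "p \<le> b" using a b m by (auto intro!: p_le)
    then have "p * p \<le> m" unfolding b by (rule mult_le_mono)
    with m_less have "p * p < C * p" by linarith
    then have "p < C" by simp
    have "n < p * (C * p)" using m m_less \<open>p > 1\<close> by simp
    also have "\<dots> \<le> C * (C * C)"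
      using \<open>p < C\<close> by (intro mult_le_mono) auto
    finally show False using large by (simp add: C_def power3_eq_cube mult_ac)
  qed
  have "m \<noteq> p"
  proof
    assume "m = p"
    then have "p * p = A * (p * p) + k\<^sup>2"
      using eq sigma2_prime_square[OF p(1)] by (simp add: m power2_eq_square)
    moreover have "p * p \<le> A * (p * p)" using \<open>A > 0\<close> by simp
    moreover have "k\<^sup>2 > 0" using \<open>k > 0\<close> by simp
    ultimately show False by linarith
  qed
  moreover have "p \<le> m" using \<open>m \<noteq> 1\<close> m by (intro p_le) auto
  ultimately have "p < m" by simp
  moreover have "p\<^sup>2 + m\<^sup>2 = A * (p * m) + k\<^sup>2"
    using eq sigma2_prime_times_prime[OF p(1) \<open>prime m\<close>] \<open>p < m\<close> by (simp add: m)
  ultimately show thesis using that p(1) \<open>prime m\<close> m by blast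
qed

text \<open>Subtracting 2 p q gives (q - p)^2 = (A - 2) p q + k^2, and the sign of A - 2 separates
  the cases. Integers are used because A - 2 may be negative.\<close>

lemma prime_solutions_quadratic:
  fixes A k p q :: nat
  assumes "A > 0" "prime p" "prime q" "p < q"
    and eq: "p\<^sup>2 + q\<^sup>2 = A * (p * q) + k\<^sup>2"
  shows "(A = 1 \<and> p * q \<le> k\<^sup>2) \<or> (A = 2 \<and> q = p + k)"
proof -
  have eq': "(int q - int p)\<^sup>2 = (int A - 2) * (int p * int q) + (int k)\<^sup>2"
    using arg_cong[OF eq, of int] by (simp add: power2_eq_square algebra_simps)
  consider "A = 1" | "A = 2" | "A \<ge> 3" using \<open>A > 0\<close> by linarith
  then show ?thesis
  proof cases
    case 1
    have "0 \<le> (int q - int p)\<^sup>2" by simp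
    with 1 eq' have "int (p * q) \<le> int (k\<^sup>2)" by simp
    then show ?thesis using 1 by (simp only: of_nat_le_iff) simp
  next
    case 2
    with eq' have "(int q - int p)\<^sup>2 = (int k)\<^sup>2" by simp
    then have "int q - int p = int k" using \<open>p < q\<close> by (simp add: power2_eq_iff)
    then show ?thesis using 2 by auto
  next
    case 3
    have "p > 1" using assms prime_gt_1_nat by blast
    \<comment> \<open>If p = k, then p - k = 0 is divisible by \<open>q\<close> and yields no bound
      on \<open>q\<close>; but the equation then reduces to q = A p, impossible for distinct
      primes.\<close>
    have "p \<noteq> k"
    proof
      assume "p = k"
      then have "q * q = (A * p) * q" using eq by (simp add: power2_eq_square mult_ac)
      then have "q = A * p" using \<open>p < q\<close> by simp
      then have "p dvd q" by simp
      then show False using assms primes_dvd_imp_eq by blast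
    qed
    have "(int p - int k) * (int p + int k) = int q * (int A * int p - int q)"
      using arg_cong[OF eq, of int] by (simp add: power2_eq_square algebra_simps)
    then have "int q dvd (int p - int k) * (int p + int k)" by simp
    then have "int q dvd int p - int k \<or> int q dvd int p + int k"
      using assms by (subst (asm) prime_dvd_mult_iff) auto
    then have "int q \<le> int p + int k"
    proof
      assume "int q dvd int p - int k"
      then have "int q \<le> \<bar>int p - int k\<bar>"
        using \<open>p \<noteq> k\<close> by (intro zdvd_imp_le) auto
      then show ?thesis by linarith
    next
      assume "int q dvd int p + int k"
      then show ?thesis using \<open>p > 1\<close> by (intro zdvd_imp_le) auto
    qed
    \<comment> \<open>This caps the square at k^2, whereas for A \<ge> 3 the quadratic identity
      makes it exceed k^2.\<close>
    then have "(int q - int p)\<^sup>2 \<le> (int k)\<^sup>2" using \<open>p < q\<close> by (intro power_mono) auto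
    moreover have "0 < (int A - 2) * (int p * int q)"
      using 3 \<open>p > 1\<close> \<open>p < q\<close> by (intro mult_pos_pos) auto
    ultimately show ?thesis using eq' by linarith
  qed
qed

lemma large_solution_form:
  fixes A k n :: nat
  assumes "A > 0" "k > 0" "n > 0"
    and eq: "int (sigma2 n) - (int n) ^ 2 = int A * int n + ((int k) ^ 2 + 1)"
    and large: "(A + k\<^sup>2 + 1) ^ 3 \<le> n"
  shows "A = 2 \<and> (\<exists>p. n = p * (p + k) \<and> prime p \<and> prime (p + k))"
proof -
  have "int (sigma2 n) = int (n\<^sup>2 + A * n + k\<^sup>2 + 1)" using eq by simp
  then have eq': "sigma2 n = n\<^sup>2 + A * n + k\<^sup>2 + 1" by (simp only: of_nat_eq_iff)
  obtain p q where pq: "prime p" "prime q" "p < q" "n = p * q" "p\<^sup>2 + q\<^sup>2 = A * (p * q) + k\<^sup>2"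
    using large_solution_is_product_of_two_primes[OF assms(1-3) eq' large] .
  \<comment> \<open>The size bound yields n > k^2, which excludes the alternative A = 1.\<close>
  have "k\<^sup>2 < A + k\<^sup>2 + 1" by simp
  also have "\<dots> \<le> (A + k\<^sup>2 + 1) ^ 3" by (rule self_le_power) auto
  finally have "k\<^sup>2 < p * q" using large pq(4) by linarith
  then have "A = 2" "q = p + k"
    using prime_solutions_quadratic[OF \<open>A > 0\<close> pq(1,2,3,5)] by auto
  then show ?thesis using pq by blast
qed

theorem theorem1p6:
  fixes A k :: nat
  assumes "A > 0" and "k > 0"
  shows "(A \<noteq> 2 \<or> odd k \<longrightarrow>
            finite {n::nat. n > 0 \<and>
              int (sigma2 n) - (int n) ^ 2 = int A * int n + ((int k) ^ 2 + 1)})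
       \<and> (A = 2 \<and> even k \<longrightarrow>
            (\<forall>n::nat. n > 0 \<longrightarrow>
              int (sigma2 n) - (int n) ^ 2 = int A * int n + ((int k) ^ 2 + 1) \<longrightarrow>
              int n \<ge> (\<bar>int A\<bar> + (int k) ^ 2 + 1) ^ 3 \<longrightarrow>
              (\<exists>p::nat. n = p * (p + k) \<and> prime p \<and> prime (p + k))))"
proof (intro conjI impI allI)
  assume *: "A \<noteq> 2 \<or> odd k"
  let ?S = "{n::nat. n > 0 \<and>
              int (sigma2 n) - (int n) ^ 2 = int A * int n + ((int k) ^ 2 + 1)}"
  \<comment> \<open>A solution beyond the bound needs A = 2, hence odd \<open>k\<close>. Then
    \<open>p\<close> and p + k have opposite parity, so p = 2, the smaller prime, and 2 (2 + k) is
    the only possible exception.\<close>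
  have "?S \<subseteq> {..<(A + k\<^sup>2 + 1) ^ 3} \<union> {2 * (2 + k)}"
  proof
    fix n assume n: "n \<in> ?S"
    show "n \<in> {..<(A + k\<^sup>2 + 1) ^ 3} \<union> {2 * (2 + k)}"
    proof (cases "(A + k\<^sup>2 + 1) ^ 3 \<le> n")
      case True
      then have "A = 2 \<and> (\<exists>p. n = p * (p + k) \<and> prime p \<and> prime (p + k))"
        using large_solution_form[OF assms] n by blast
      then obtain p where p: "n = p * (p + k)" "prime p" "prime (p + k)" and "odd k"
        using * by blast
      have "p = 2"
      proof (rule ccontr)
        assume "p \<noteq> 2"
        then have "odd p" "p > 2" using p prime_odd_nat prime_ge_2_nat[of p] by auto
        then have "odd (p + k)" using p by (intro prime_odd_nat) auto
        then show False using \<open>odd p\<close> \<open>odd k\<close> by simp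
      qed
      then show ?thesis using p by simp
    qed simp
  qed
  then show "finite ?S" by (rule finite_subset) simp
next
  fix n :: nat
  assume "n > 0"
    and eq: "int (sigma2 n) - (int n) ^ 2 = int A * int n + ((int k) ^ 2 + 1)"
    and "(\<bar>int A\<bar> + (int k) ^ 2 + 1) ^ 3 \<le> int n"
  then have "int ((A + k\<^sup>2 + 1) ^ 3) \<le> int n" by (simp add: add_ac)
  then have "(A + k\<^sup>2 + 1) ^ 3 \<le> n" by (simp only: of_nat_le_iff)
  then show "\<exists>p. n = p * (p + k) \<and> prime p \<and> prime (p + k)"
    using large_solution_form[OF assms \<open>n > 0\<close> eq] by blast
qed

end
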